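(* Let $F$ be a friend of $10$ written as $F=5^{2a_1}\cdot\prod_{i=2}^{\omega(F)}p_i^{2a_i}$, where $p_1=5$, the $p_i$ for $2\le i\le \omega(F)$ are distinct prime numbers with $p_i>5$, and $a_1,\dots,a_{\omega(F)}$ are positive integers. Then $$F>\frac{25}{81}\cdot\prod_{i=1}^{\omega(F)}(2a_i+1)^2.$$
   Context: For a positive integer $n$, $\sigma(n)$ denotes the sum of the positive divisors of $n$, $I(n)=\sigma(n)/n$ is the abundancy index of $n$, and $\omega(n)$ is the number of distinct prime divisors of $n$. Two distinct positive integers are friends of each other if they have the same abundancy index. Thus a friend of $10$ is a positive integer $F\neq 10$ with $I(F)=I(10)=9/5$, i.e. $5\sigma(F)=9F$. *)

theory Defs
  imports Complex_Main "HOL-Computational_Algebra.Primes"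
begin

definition sigma :: "nat \<Rightarrow> nat" where
  "sigma n = (\<Sum>d | d dvd n. d)"

definition abundancy :: "nat \<Rightarrow> real" where
  "abundancy n = real (sigma n) / real n"

definition omega :: "nat \<Rightarrow> nat" where
  "omega n = card (prime_factors n)"

definition friends :: "nat \<Rightarrow> nat \<Rightarrow> bool" where
  "friends m n \<longleftrightarrow> m > 0 \<and> n > 0 \<and> m \<noteq> n \<and> abundancy m = abundancy n"

end

theory Submission
  imports Defs
begin

text \<open>Pairing each divisor \<open>d\<close> of \<open>n > 1\<close> with \<open>n / d\<close> and applying AM-GM shows that
  \<open>\<sigma>(n) > \<surd>n \<cdot> \<tau>(n)\<close>, where \<open>\<tau>(n)\<close> is the number of divisors. For a friend
  \<open>F\<close> of 10 we have \<open>\<sigma>(F) = 9F/5\<close>, hence \<open>\<surd>F > (5/9) \<tau>(F)\<close>; now square.\<close>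

text \<open>Multiplication is a bijection from pairs of divisors to divisors of
  \<open>m * n\<close>: coprimality makes it injective, and every divisor of a product splits into
  divisors of the factors.\<close>

lemma card_divisors_mult_coprime:
  fixes m n :: nat
  assumes "coprime m n"
  shows "card {d. d dvd m * n} = card {d. d dvd m} * card {d. d dvd n}"
proof -
  let ?f = "\<lambda>(x, y). x * y :: nat"
  have inj: "inj_on ?f ({d. d dvd m} \<times> {d. d dvd n})"
  proof (rule inj_onI, clarsimp)
    fix x y x' y' :: nat
    assume *: "x dvd m" "y dvd n" "x' dvd m" "y' dvd n" "x * y = x' * y'"
    \<comment> \<open>\<open>x\<close> divides \<open>x' * y'\<close> and is coprime to
      \<open>y'\<close>, so it divides \<open>x'\<close>. The symmetric arguments and antisymmetry
      give both equalities.\<close>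
    have "coprime x y'" "coprime x' y" "coprime y x'" "coprime y' x"
      using * assms by (meson coprime_divisors coprime_commute)+
    moreover have "x dvd x' * y'" "x' dvd x * y" "y dvd x' * y'" "y' dvd x * y"
      using *(5) by (metis dvd_triv_left dvd_triv_right)+
    ultimately show "x = x' \<and> y = y'"
      by (simp add: coprime_dvd_mult_left_iff coprime_dvd_mult_right_iff dvd_antisym)
  qed
  have "?f ` ({d. d dvd m} \<times> {d. d dvd n}) = {d. d dvd m * n}"
  proof
    show "{d. d dvd m * n} \<subseteq> ?f ` ({d. d dvd m} \<times> {d. d dvd n})"
    proof
      fix d assume "d \<in> {d. d dvd m * n}"
      then obtain x y where "d = x * y" "x dvd m" "y dvd n"
        using division_decomp by blast
      then show "d \<in> ?f ` ({d. d dvd m} \<times> {d. d dvd n})"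
        by (intro image_eqI[of _ _ "(x, y)"]) auto
    qed
  qed (auto simp: mult_dvd_mono)
  then show ?thesis
    using card_image[OF inj] by (simp add: card_cartesian_product)
qed

lemma card_divisors_prime_power:
  fixes p :: nat
  assumes "prime p"
  shows "card {d. d dvd p ^ k} = k + 1"
proof -
  have "{d. d dvd p ^ k} = (\<lambda>i. p ^ i) ` {..k}"
    using divides_primepow_nat[OF assms] by auto
  moreover have "inj_on (\<lambda>i. p ^ i) {..k}"
    using prime_gt_1_nat[OF assms] by (auto intro: inj_onI)
  ultimately show ?thesis
    by (simp add: card_image)
qed

lemma card_divisors_prod_prime_powers:
  fixes p k :: "'a \<Rightarrow> nat"
  assumes "finite A" "\<And>i. i \<in> A \<Longrightarrow> prime (p i)" "inj_on p A"
  shows "card {d. d dvd (\<Prod>i\<in>A. p i ^ k i)} = (\<Prod>i\<in>A. k i + 1)"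
  using assms
proof (induction A rule: finite_induct)
  case (insert x A)
  \<comment> \<open>Injectivity of \<open>p\<close> keeps the new prime apart from all earlier
    ones.\<close>
  have "coprime (p x ^ k x) (\<Prod>i\<in>A. p i ^ k i)"
  proof (rule prod_coprime_right)
    fix i assume "i \<in> A"
    moreover from this insert have "p x \<noteq> p i" by auto
    ultimately show "coprime (p x ^ k x) (p i ^ k i)"
      using insert by (simp add: primes_coprime)
  qed
  then show ?case
    using insert by (simp add: card_divisors_mult_coprime card_divisors_prime_power)
qed simp

lemma sigma_gt_sqrt_mult_card_divisors:
  assumes "n > 1"
  shows "real (sigma n) > sqrt (real n) * real (card {d. d dvd n})"
proof -
  let ?D = "{d. d dvd n}"
  have fin: "finite ?D" using assms by simp
  have inj: "inj_on (\<lambda>d. n div d) ?D"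
  proof (rule inj_on_inverseI)
    fix d assume "d \<in> ?D"
    then obtain k where "n = d * k" by auto
    with assms show "n div (n div d) = d" by auto
  qed
  \<comment> \<open>An injective self-map of a finite set is onto, so the sum over divisors may be
    reindexed by codivisors.\<close>
  have "(\<lambda>d. n div d) ` ?D = ?D"
    by (rule endo_inj_surj[OF fin _ inj]) (auto simp: div_dvd_iff_mult)
  then have "(\<Sum>d\<in>?D. real d) = (\<Sum>d\<in>?D. real (n div d))"
    using sum.reindex[OF inj, of real] by simp
  then have "2 * real (sigma n) = (\<Sum>d\<in>?D. real d + real (n div d))"
    by (simp add: sigma_def sum.distrib)
  also have "\<dots> > (\<Sum>d\<in>?D. 2 * sqrt (real n))"
  proof (rule sum_strict_mono_ex1[OF fin])
    show "\<forall>d\<in>?D. 2 * sqrt (real n) \<le> real d + real (n div d)"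
    proof
      fix d assume "d \<in> ?D"
      then have "real n = real d * real (n div d)"
        by (metis dvd_mult_div_cancel mem_Collect_eq of_nat_mult)
      then show "2 * sqrt (real n) \<le> real d + real (n div d)"
        using arith_geo_mean_sqrt[of "real d" "real (n div d)"] by simp
    qed
    \<comment> \<open>Strictness comes from the single pair of \<open>1\<close> and
      \<open>n\<close>, where AM-GM is strict because \<open>n > 1\<close>.\<close>
    have "0 < (sqrt (real n) - 1)\<^sup>2"
      using assms by simp
    then have "2 * sqrt (real n) < 1 + real n"
      by (simp add: power2_diff)
    then show "\<exists>d\<in>?D. 2 * sqrt (real n) < real d + real (n div d)"
      by (intro bexI[of _ 1]) auto
  qed
  finally show ?thesis
    by (simp add: mult.commute)
qed

text \<open>Supplies the abundancy index 18/10 = 9/5 of 10.\<close>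

lemma sigma_10: "sigma 10 = 18"
proof -
  have "{d::nat. d dvd 10} = Set.filter (\<lambda>d. d dvd 10) {1..10}"
    by (auto dest: dvd_imp_le intro!: Suc_leI intro: Nat.gr0I)
  also have "{1..10::nat} = {1, 2, 3, 4, 5, 6, 7, 8, 9, 10}"
    by (simp add: numeral_eq_Suc atLeastAtMostSuc_conv insert_commute)
  also have "Set.filter (\<lambda>d. d dvd 10) \<dots> = {1, 2, 5, 10}"
    by auto
  finally show ?thesis
    by (simp add: sigma_def)
qed

theorem theorem1p5:
  fixes F :: nat and p a :: "nat \<Rightarrow> nat"
  assumes friend: "friends F 10"
    and p1: "p 1 = 5"
    and p_prime: "\<And>i. i \<in> {2..omega F} \<Longrightarrow> prime (p i)"
    and p_gt: "\<And>i. i \<in> {2..omega F} \<Longrightarrow> p i > 5"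
    and p_distinct: "inj_on p {2..omega F}"
    and a_pos: "\<And>i. i \<in> {1..omega F} \<Longrightarrow> a i > 0"
    and factorization: "F = 5 ^ (2 * a 1) * (\<Prod>i = 2..omega F. p i ^ (2 * a i))"
  shows "real F > 25 / 81 * (\<Prod>i = 1..omega F. (2 * real (a i) + 1) ^ 2)"
proof (cases "omega F = 0")
  \<comment> \<open>The product is empty here, so the bound reads \<open>F > 25 / 81\<close>, which
    holds for any positive integer.\<close>
  case True
  then show ?thesis
    using friend by (simp add: friends_def)
next
  case False
  then have I: "{1..omega F} = insert 1 {2..omega F}" by auto
  have "5 ^ (2 * a 1) * (\<Prod>i = 2..omega F. p i ^ (2 * a i))
      = (\<Prod>i = 1..omega F. p i ^ (2 * a i))"
    using p1 unfolding I by simp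
  with factorization have F: "F = (\<Prod>i = 1..omega F. p i ^ (2 * a i))"
    by (rule trans)
  have "prime (5::nat)"
    by simp
  then have "\<And>i. i \<in> {1..omega F} \<Longrightarrow> prime (p i)"
    using p_prime p1 unfolding I by auto
  \<comment> \<open>The value 5 at index 1 cannot recur, since all other \<open>p i\<close> exceed
    5.\<close>
  moreover have "inj_on p {1..omega F}"
    using p_distinct p_gt p1 unfolding I by fastforce
  ultimately have card: "card {d. d dvd F} = (\<Prod>i = 1..omega F. 2 * a i + 1)"
    using card_divisors_prod_prime_powers[of "{1..omega F}" p "\<lambda>i. 2 * a i"]
    unfolding F[symmetric] by blast
  have pos: "F > 0"
    using friend by (simp add: friends_def)
  then have abund: "real (sigma F) = 9 / 5 * real F"
    using friend by (simp add: friends_def abundancy_def sigma_10 field_simps)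
  \<comment> \<open>The number 1 has no prime factor, contradicting \<open>omega F\<close> being
    nonzero. This secures \<open>F > 1\<close> for the strict bound.\<close>
  have "F \<noteq> 1"
    using False by (auto simp: omega_def)
  then have "9 / 5 * real F > sqrt (real F) * real (card {d. d dvd F})"
    using sigma_gt_sqrt_mult_card_divisors[of F] pos abund by simp
  \<comment> \<open>Splitting off one factor \<open>sqrt (real F)\<close>, which is positive, allows
    it to be cancelled on both sides.\<close>
  also have "9 / 5 * real F = sqrt (real F) * (9 / 5 * sqrt (real F))"
    by simp
  finally have "sqrt (real F) > 5 / 9 * real (card {d. d dvd F})"
    using pos by simp
  \<comment> \<open>Squaring produces the constant 25/81 as the square of 5/9, and the squared
    factors \<open>2 * a i + 1\<close>.\<close>
  then have "(sqrt (real F))\<^sup>2 > (5 / 9 * real (card {d. d dvd F}))\<^sup>2"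
    by (intro power_strict_mono) auto
  then show ?thesis
    by (simp add: card power_mult_distrib prod_power_distrib power_divide add.commute)
qed

end
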